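(* Let $X$ be an ordered Banach space whose cone $X_+$ is closed, generating and normal, and let $Y$ be a normed space. (i) If $X$ has $\sigma$-order continuous norm, then $\mathrm{L}^\sigma_{Leb}(X,Y)=\mathrm{L}^\sigma_{onc}(X,Y)$ and $\mathrm{L}^\sigma_{wLeb}(X,Y)=\mathrm{L}^\sigma_{owc}(X,Y)$. (ii) If $X$ has order continuous norm, then $\mathrm{L}_{Leb}(X,Y)=\mathrm{L}_{onc}(X,Y)$ and $\mathrm{L}_{wLeb}(X,Y)=\mathrm{L}_{owc}(X,Y)$.
   Context: Vector spaces are real and operators are linear (not assumed continuous). An ordered vector space $X$ is a real vector space with a cone $X_+$ (a convex cone with $X_+\cap(-X_+)=\{0\}$), ordered by $x\le y$ iff $y-x\in X_+$. An ordered Banach space is a Banach space that is also an ordered vector space. The cone $X_+$ is closed if it is norm closed, generating if $X_+-X_+=X$, and normal if there is a constant $N$ such that $0\le x\le y$ implies $\|x\|\le N\|y\|$. The notation $x_\alpha\downarrow 0$ means that the net $(x_\alpha)$ is decreasing and $\inf_\alpha x_\alpha=0$. A net $(x_\alpha)$ (in particular a sequence) order converges to $0$ if there is a net $g_\beta\downarrow 0$ in $X$ such that for each $\beta$ there is $\alpha_\beta$ with $\pm x_\alpha\le g_\beta$ for all $\alpha\ge\alpha_\beta$. The norm of $X$ is order continuous (respectively $\sigma$-order continuous) if $\|x_\alpha\|\to0$ for every net (respectively sequence) in $X$ that order converges to $0$. The following are sets of linear operators $T:X\to Y$: $\mathrm{L}_{Leb}(X,Y)$ (respectively $\mathrm{L}^\sigma_{Leb}(X,Y)$):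 $\|Tx_\alpha\|\to0$ for every net (respectively sequence) $x_\alpha\downarrow0$ in $X$. $\mathrm{L}_{wLeb}(X,Y)$ (respectively $\mathrm{L}^\sigma_{wLeb}(X,Y)$): $Tx_\alpha\to0$ weakly for every net (respectively sequence) $x_\alpha\downarrow0$ in $X$. $\mathrm{L}_{onc}(X,Y)$ (respectively $\mathrm{L}^\sigma_{onc}(X,Y)$): $\|Tx_\alpha\|\to0$ for every net (respectively sequence) that order converges to $0$ in $X$. $\mathrm{L}_{owc}(X,Y)$ (respectively $\mathrm{L}^\sigma_{owc}(X,Y)$): $Tx_\alpha\to0$ weakly for every net (respectively sequence) that order converges to $0$ in $X$. *)

theory Defs
  imports "HOL-Analysis.Analysis"
begin

text \<open>
  An ordered vector space is a type of class \<^class>\<open>ordered_real_vector\<close>, its cone being the set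
  of nonnegative elements; an ordered Banach space is a type that moreover is of class
  \<^class>\<open>banach\<close>. No compatibility of order and norm is built in.
\<close>

definition pos_cone :: "'a::ordered_real_vector set" where
  "pos_cone = {x. 0 \<le> x}"

definition generating_cone :: "'a::ordered_real_vector itself \<Rightarrow> bool" where
  "generating_cone _ \<longleftrightarrow> {u - v | u v. u \<in> pos_cone \<and> v \<in> pos_cone} = (UNIV :: 'a set)"

definition normal_cone :: "'a::{ordered_real_vector, real_normed_vector} itself \<Rightarrow> bool" where
  "normal_cone _ \<longleftrightarrow> (\<exists>N::real. \<forall>x y::'a. 0 \<le> x \<and> x \<le> y \<longrightarrow> norm x \<le> N * norm y)"


text \<open>
  A net is a family indexed by a nonempty set \<open>A\<close> that is directed by a preorder \<open>le\<close>. A sequence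
  is a net with \<open>A = UNIV\<close> and \<open>le = (\<le>)\<close> on \<^typ>\<open>nat\<close>.
\<close>

definition directed_by :: "'i set \<Rightarrow> ('i \<Rightarrow> 'i \<Rightarrow> bool) \<Rightarrow> bool" where
  "directed_by A le \<longleftrightarrow> A \<noteq> {} \<and> reflp_on A le \<and> transp_on A le \<and>
     (\<forall>a\<in>A. \<forall>b\<in>A. \<exists>c\<in>A. le a c \<and> le b c)"

definition tails :: "'i set \<Rightarrow> ('i \<Rightarrow> 'i \<Rightarrow> bool) \<Rightarrow> 'i filter" where
  "tails A le = (INF a\<in>A. principal {b\<in>A. le a b})"

lemma eventually_tails:
  assumes "directed_by A le"
  shows "eventually P (tails A le) \<longleftrightarrow> (\<exists>a\<in>A. \<forall>b\<in>A. le a b \<longrightarrow> P b)"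
proof -
  have "eventually P (tails A le) \<longleftrightarrow>
      (\<exists>a\<in>A. eventually P (principal {b\<in>A. le a b}))"
    unfolding tails_def
  proof (rule eventually_INF_base)
    show "A \<noteq> {}" using assms by (simp add: directed_by_def)
    fix a b assume ab: "a \<in> A" "b \<in> A"
    then obtain c where c: "c \<in> A" "le a c" "le b c"
      using assms by (auto simp: directed_by_def)
    have "{d\<in>A. le c d} \<subseteq> {d\<in>A. le a d} \<inter> {d\<in>A. le b d}"
      using assms ab c unfolding directed_by_def by (auto dest: transp_onD)
    with c show "\<exists>x\<in>A. principal {b \<in> A. le x b} \<le>
        inf (principal {b \<in> A. le a b}) (principal {c \<in> A. le b c})"
      by auto
  qed
  then show ?thesis by (auto simp: eventually_principal)
qed

lemma directed_by_nat: "directed_by (UNIV :: nat set) (\<le>)"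
  unfolding directed_by_def
  by (auto intro!: reflp_onI transp_onI) (meson max.cobounded1 max.cobounded2)

lemma tails_nat: "tails (UNIV :: nat set) (\<le>) = sequentially"
  by (rule filter_eqI) (auto simp: eventually_tails[OF directed_by_nat] eventually_sequentially)

text \<open>\<open>x\<^sub>\<alpha> \<down> 0\<close>\<close>

definition decreases_to_zero ::
    "'i set \<Rightarrow> ('i \<Rightarrow> 'i \<Rightarrow> bool) \<Rightarrow> ('i \<Rightarrow> 'a::ordered_real_vector) \<Rightarrow> bool" where
  "decreases_to_zero A le x \<longleftrightarrow> directed_by A le \<and> monotone_on A le (\<ge>) x \<and>
     (\<forall>a\<in>A. 0 \<le> x a) \<and> (\<forall>z. (\<forall>a\<in>A. z \<le> x a) \<longrightarrow> z \<le> 0)"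

text \<open>
  A definition cannot quantify over all index types. All nets in \<open>'a\<close> are therefore indexed by
  subsets of the one type \<^typ>\<open>'a set \<times> 'a\<close>, which is large enough: the lemmas ending in
  \<open>any_index\<close> show that every notion below is the one obtained from nets over arbitrary
  index types.
\<close>

type_synonym 'a idx = "'a set \<times> 'a"

definition order_null ::
    "'i set \<Rightarrow> ('i \<Rightarrow> 'i \<Rightarrow> bool) \<Rightarrow> ('i \<Rightarrow> 'a::ordered_real_vector) \<Rightarrow> bool" where
  "order_null A le x \<longleftrightarrow> directed_by A le \<and>
     (\<exists>(B :: 'a idx set) leB g. decreases_to_zero B leB g \<and>
        (\<forall>b\<in>B. \<exists>a\<^sub>b\<in>A. \<forall>a\<in>A. le a\<^sub>b a \<longrightarrow> x a \<le> g b \<and> - x a \<le> g b))"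

definition weakly_null :: "('i \<Rightarrow> 'b::real_normed_vector) \<Rightarrow> 'i filter \<Rightarrow> bool" where
  "weakly_null y F \<longleftrightarrow> (\<forall>f :: 'b \<Rightarrow> real. bounded_linear f \<longrightarrow> ((\<lambda>a. f (y a)) \<longlongrightarrow> 0) F)"

definition order_continuous_norm ::
    "'a::{ordered_real_vector, real_normed_vector} itself \<Rightarrow> bool" where
  "order_continuous_norm _ \<longleftrightarrow> (\<forall>(A :: 'a idx set) le (x :: 'a idx \<Rightarrow> 'a).
     order_null A le x \<longrightarrow> ((\<lambda>a. norm (x a)) \<longlongrightarrow> 0) (tails A le))"

definition sigma_order_continuous_norm ::
    "'a::{ordered_real_vector, real_normed_vector} itself \<Rightarrow> bool" where
  "sigma_order_continuous_norm _ \<longleftrightarrow> (\<forall>x :: nat \<Rightarrow> 'a.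
     order_null UNIV (\<le>) x \<longrightarrow> (\<lambda>n. norm (x n)) \<longlonglongrightarrow> 0)"


definition L_Leb ::
    "('a::{ordered_real_vector, real_normed_vector} \<Rightarrow> 'b::real_normed_vector) set" where
  "L_Leb = {T. linear T \<and> (\<forall>(A :: 'a idx set) le x.
     decreases_to_zero A le x \<longrightarrow> ((\<lambda>a. norm (T (x a))) \<longlongrightarrow> 0) (tails A le))}"

definition L_Leb_sigma ::
    "('a::{ordered_real_vector, real_normed_vector} \<Rightarrow> 'b::real_normed_vector) set" where
  "L_Leb_sigma = {T. linear T \<and> (\<forall>x :: nat \<Rightarrow> 'a.
     decreases_to_zero UNIV (\<le>) x \<longrightarrow> (\<lambda>n. norm (T (x n))) \<longlonglongrightarrow> 0)}"

definition L_wLeb ::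
    "('a::{ordered_real_vector, real_normed_vector} \<Rightarrow> 'b::real_normed_vector) set" where
  "L_wLeb = {T. linear T \<and> (\<forall>(A :: 'a idx set) le x.
     decreases_to_zero A le x \<longrightarrow> weakly_null (\<lambda>a. T (x a)) (tails A le))}"

definition L_wLeb_sigma ::
    "('a::{ordered_real_vector, real_normed_vector} \<Rightarrow> 'b::real_normed_vector) set" where
  "L_wLeb_sigma = {T. linear T \<and> (\<forall>x :: nat \<Rightarrow> 'a.
     decreases_to_zero UNIV (\<le>) x \<longrightarrow> weakly_null (\<lambda>n. T (x n)) sequentially)}"

definition L_onc ::
    "('a::{ordered_real_vector, real_normed_vector} \<Rightarrow> 'b::real_normed_vector) set" where
  "L_onc = {T. linear T \<and> (\<forall>(A :: 'a idx set) le x.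
     order_null A le x \<longrightarrow> ((\<lambda>a. norm (T (x a))) \<longlongrightarrow> 0) (tails A le))}"

definition L_onc_sigma ::
    "('a::{ordered_real_vector, real_normed_vector} \<Rightarrow> 'b::real_normed_vector) set" where
  "L_onc_sigma = {T. linear T \<and> (\<forall>x :: nat \<Rightarrow> 'a.
     order_null UNIV (\<le>) x \<longrightarrow> (\<lambda>n. norm (T (x n))) \<longlonglongrightarrow> 0)}"

definition L_owc ::
    "('a::{ordered_real_vector, real_normed_vector} \<Rightarrow> 'b::real_normed_vector) set" where
  "L_owc = {T. linear T \<and> (\<forall>(A :: 'a idx set) le x.
     order_null A le x \<longrightarrow> weakly_null (\<lambda>a. T (x a)) (tails A le))}"

definition L_owc_sigma ::
    "('a::{ordered_real_vector, real_normed_vector} \<Rightarrow> 'b::real_normed_vector) set" where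
  "L_owc_sigma = {T. linear T \<and> (\<forall>x :: nat \<Rightarrow> 'a.
     order_null UNIV (\<le>) x \<longrightarrow> weakly_null (\<lambda>n. T (x n)) sequentially)}"


text \<open>Independence of the index type\<close>

lemma decreasing_net_reindex:
  fixes x :: "'i \<Rightarrow> 'a::ordered_real_vector"
  assumes "decreases_to_zero A le x"
  obtains B :: "'a idx set" and leB y where
    "decreases_to_zero B leB y" "y ` B = x ` A"
    "filtermap x (tails A le) \<le> filtermap y (tails B leB)"
proof -
  define B :: "'a idx set" where "B = {{}} \<times> x ` A"
  define leB where "leB = (\<lambda>(p :: 'a idx) (q :: 'a idx). snd q \<le> snd p)"
  have dir: "directed_by A le" and mono: "monotone_on A le (\<ge>) x"
    using assms by (auto simp: decreases_to_zero_def)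
  have ub: "\<exists>c\<in>A. x c \<le> x a \<and> x c \<le> x b" if "a \<in> A" "b \<in> A" for a b
    using dir mono that unfolding directed_by_def monotone_on_def by meson
  have dirB: "directed_by B leB"
    unfolding directed_by_def
  proof (intro conjI ballI)
    show "B \<noteq> {}" using dir by (auto simp: B_def directed_by_def)
    show "reflp_on B leB" "transp_on B leB"
      by (auto simp: leB_def intro!: reflp_onI transp_onI)
    show "\<exists>c\<in>B. leB p c \<and> leB q c" if "p \<in> B" "q \<in> B" for p q
      using that ub by (fastforce simp: B_def leB_def)
  qed
  have im: "snd ` B = x ` A" by (force simp: B_def)
  show thesis
  proof (rule that)
    show "snd ` B = x ` A" by (fact im)
    have "(\<forall>p\<in>B. Q (snd p)) \<longleftrightarrow> (\<forall>a\<in>A. Q (x a))" for Q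
      by (auto simp: B_def)
    then show "decreases_to_zero B leB snd"
      using assms dirB by (auto simp: decreases_to_zero_def monotone_on_def leB_def)
    show "filtermap x (tails A le) \<le> filtermap snd (tails B leB)"
    proof (rule filter_leI)
      fix P assume "eventually P (filtermap snd (tails B leB))"
      then obtain p where p: "p \<in> B" "\<And>q. q \<in> B \<Longrightarrow> leB p q \<Longrightarrow> P (snd q)"
        by (auto simp: eventually_filtermap eventually_tails[OF dirB])
      then obtain a where a: "a \<in> A" "\<And>b. b \<in> A \<Longrightarrow> x b \<le> x a \<Longrightarrow> P (x b)"
        by (fastforce simp: B_def leB_def)
      with mono have "\<forall>b\<in>A. le a b \<longrightarrow> P (x b)"
        by (auto simp: monotone_on_def)
      with a(1) show "eventually P (filtermap x (tails A le))"
        by (auto simp: eventually_filtermap eventually_tails[OF dir])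
    qed
  qed
qed

lemma order_null_any_index:
  fixes x :: "'i \<Rightarrow> 'a::ordered_real_vector" and g :: "'j \<Rightarrow> 'a"
  assumes "directed_by A le" and "decreases_to_zero B leB g"
    and "\<forall>b\<in>B. \<exists>a\<^sub>b\<in>A. \<forall>a\<in>A. le a\<^sub>b a \<longrightarrow> x a \<le> g b \<and> - x a \<le> g b"
  shows "order_null A le x"
proof -
  obtain C :: "'a idx set" and leC h where
    h: "decreases_to_zero C leC h" "h ` C = g ` B"
    using decreasing_net_reindex[OF assms(2)] by metis
  have "\<exists>a\<^sub>b\<in>A. \<forall>a\<in>A. le a\<^sub>b a \<longrightarrow> x a \<le> h c \<and> - x a \<le> h c" if "c \<in> C" for c
  proof -
    from that h(2) obtain b where "b \<in> B" "h c = g b" by (metis image_iff)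
    with assms(3) show ?thesis by auto
  qed
  with assms(1) h(1) show ?thesis unfolding order_null_def by blast
qed

lemma order_null_net_reindex:
  fixes x :: "'i \<Rightarrow> 'a::ordered_real_vector"
  assumes "order_null A le x"
  obtains B :: "'a idx set" and leB y where
    "order_null B leB y" "filtermap x (tails A le) \<le> filtermap y (tails B leB)"
proof -
  define tl where "tl = (\<lambda>a. x ` {b\<in>A. le a b})"
  define B :: "'a idx set" where "B = (SIGMA S : tl ` A. S)"
  define leB where "leB = (\<lambda>(p :: 'a idx) (q :: 'a idx). fst q \<subseteq> fst p)"
  have dir: "directed_by A le" using assms by (simp add: order_null_def)
  have refl: "le a a" if "a \<in> A" for a
    using dir that by (auto simp: directed_by_def reflp_on_def)
  have trans: "le a c" if "le a b" "le b c" "a \<in> A" "b \<in> A" "c \<in> A" for a b c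
    using dir that unfolding directed_by_def by (meson transp_onD)
  have inB: "(tl a, x b) \<in> B" if "a \<in> A" "b \<in> A" "le a b" for a b
    using that by (auto simp: B_def tl_def)
  have dirB: "directed_by B leB"
    unfolding directed_by_def
  proof (intro conjI ballI)
    show "B \<noteq> {}" using dir inB refl by (fastforce simp: directed_by_def)
    show "reflp_on B leB" "transp_on B leB"
      by (auto simp: leB_def intro!: reflp_onI transp_onI)
    fix p q assume "p \<in> B" "q \<in> B"
    then obtain a b where ab: "a \<in> A" "b \<in> A" "fst p = tl a" "fst q = tl b"
      by (auto simp: B_def)
    then obtain c where c: "c \<in> A" "le a c" "le b c"
      using dir unfolding directed_by_def by metis
    have "tl c \<subseteq> tl a" "tl c \<subseteq> tl b"
      using ab(1,2) c trans by (auto simp: tl_def)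
    with ab c inB[OF c(1) c(1) refl[OF c(1)]] show "\<exists>c\<in>B. leB p c \<and> leB q c"
      by (intro bexI[of _ "(tl c, x c)"]) (auto simp: leB_def)
  qed
  show thesis
  proof (rule that)
    obtain C :: "'a idx set" and leC g where g: "decreases_to_zero C leC g"
      "\<And>c. c \<in> C \<Longrightarrow> \<exists>a\<^sub>b\<in>A. \<forall>a\<in>A. le a\<^sub>b a \<longrightarrow> x a \<le> g c \<and> - x a \<le> g c"
      using assms unfolding order_null_def by blast
    have "\<exists>p\<in>B. \<forall>q\<in>B. leB p q \<longrightarrow> snd q \<le> g c \<and> - snd q \<le> g c" if c: "c \<in> C" for c
    proof -
      obtain a where a: "a \<in> A" "\<forall>b\<in>A. le a b \<longrightarrow> x b \<le> g c \<and> - x b \<le> g c"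
        using g(2)[OF c] by blast
      have "snd q \<in> tl a" if "q \<in> B" "leB (tl a, x a) q" for q
        using that by (auto simp: B_def leB_def)
      with a have "\<forall>q\<in>B. leB (tl a, x a) q \<longrightarrow> snd q \<le> g c \<and> - snd q \<le> g c"
        by (fastforce simp: tl_def)
      with inB[OF a(1) a(1) refl[OF a(1)]] show ?thesis by blast
    qed
    with dirB g(1) show "order_null B leB snd"
      unfolding order_null_def by blast
    show "filtermap x (tails A le) \<le> filtermap snd (tails B leB)"
    proof (rule filter_leI)
      fix P assume "eventually P (filtermap snd (tails B leB))"
      then obtain p where p: "p \<in> B" "\<And>q. q \<in> B \<Longrightarrow> leB p q \<Longrightarrow> P (snd q)"
        by (auto simp: eventually_filtermap eventually_tails[OF dirB])
      then obtain a where a: "a \<in> A" "fst p = tl a" by (auto simp: B_def)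
      have "P (x b)" if "b \<in> A" "le a b" for b
        using p(2)[OF inB[OF a(1) that]] a(2) by (simp add: leB_def)
      with a(1) show "eventually P (filtermap x (tails A le))"
        by (auto simp: eventually_filtermap eventually_tails[OF dir])
    qed
  qed
qed

lemma tendsto_via_filtermap:
  assumes "filtermap x F \<le> filtermap y G" and "((\<lambda>a. h (y a)) \<longlongrightarrow> l) G"
  shows "((\<lambda>a. h (x a)) \<longlongrightarrow> l) F"
proof -
  have "filterlim h (nhds l) (filtermap y G)"
    using assms(2) by (simp add: filterlim_filtermap)
  then have "filterlim h (nhds l) (filtermap x F)"
    using assms(1) by (rule filterlim_mono[OF _ order_refl])
  then show ?thesis by (simp add: filterlim_filtermap)
qed

lemma order_continuous_norm_any_index:
  fixes x :: "'i \<Rightarrow> 'a::{ordered_real_vector, real_normed_vector}"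
  assumes "order_continuous_norm TYPE('a)" and "order_null A le x"
  shows "((\<lambda>a. norm (x a)) \<longlongrightarrow> 0) (tails A le)"
proof -
  obtain B leB y where y: "order_null (B :: 'a idx set) leB y"
    "filtermap x (tails A le) \<le> filtermap y (tails B leB)"
    using order_null_net_reindex[OF assms(2)] by metis
  have "((\<lambda>b. norm (y b)) \<longlongrightarrow> 0) (tails B leB)"
    using assms(1) y(1) by (auto simp: order_continuous_norm_def)
  then show ?thesis
    using tendsto_via_filtermap[OF y(2), of "norm"] by simp
qed

lemma L_Leb_any_index:
  fixes T :: "'a::{ordered_real_vector, real_normed_vector} \<Rightarrow> 'b::real_normed_vector"
    and x :: "'i \<Rightarrow> 'a"
  assumes "T \<in> L_Leb" and "decreases_to_zero A le x"
  shows "((\<lambda>a. norm (T (x a))) \<longlongrightarrow> 0) (tails A le)"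
proof -
  obtain B leB y where y: "decreases_to_zero (B :: 'a idx set) leB y"
    "filtermap x (tails A le) \<le> filtermap y (tails B leB)"
    using decreasing_net_reindex[OF assms(2)] by metis
  have "((\<lambda>b. norm (T (y b))) \<longlongrightarrow> 0) (tails B leB)"
    using assms(1) y(1) by (auto simp: L_Leb_def)
  then show ?thesis
    using tendsto_via_filtermap[OF y(2), of "\<lambda>v. norm (T v)"] by simp
qed

lemma L_onc_any_index:
  fixes T :: "'a::{ordered_real_vector, real_normed_vector} \<Rightarrow> 'b::real_normed_vector"
    and x :: "'i \<Rightarrow> 'a"
  assumes "T \<in> L_onc" and "order_null A le x"
  shows "((\<lambda>a. norm (T (x a))) \<longlongrightarrow> 0) (tails A le)"
proof -
  obtain B leB y where y: "order_null (B :: 'a idx set) leB y"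
    "filtermap x (tails A le) \<le> filtermap y (tails B leB)"
    using order_null_net_reindex[OF assms(2)] by metis
  have "((\<lambda>b. norm (T (y b))) \<longlongrightarrow> 0) (tails B leB)"
    using assms(1) y(1) by (auto simp: L_onc_def)
  then show ?thesis
    using tendsto_via_filtermap[OF y(2), of "\<lambda>v. norm (T v)"] by simp
qed

lemma L_wLeb_any_index:
  fixes T :: "'a::{ordered_real_vector, real_normed_vector} \<Rightarrow> 'b::real_normed_vector"
    and x :: "'i \<Rightarrow> 'a"
  assumes "T \<in> L_wLeb" and "decreases_to_zero A le x"
  shows "weakly_null (\<lambda>a. T (x a)) (tails A le)"
proof -
  obtain B leB y where y: "decreases_to_zero (B :: 'a idx set) leB y"
    "filtermap x (tails A le) \<le> filtermap y (tails B leB)"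
    using decreasing_net_reindex[OF assms(2)] by metis
  have "weakly_null (\<lambda>b. T (y b)) (tails B leB)"
    using assms(1) y(1) by (auto simp: L_wLeb_def)
  then show ?thesis
    using tendsto_via_filtermap[OF y(2), of "\<lambda>v. f (T v)" 0 for f]
    by (auto simp: weakly_null_def)
qed

lemma L_owc_any_index:
  fixes T :: "'a::{ordered_real_vector, real_normed_vector} \<Rightarrow> 'b::real_normed_vector"
    and x :: "'i \<Rightarrow> 'a"
  assumes "T \<in> L_owc" and "order_null A le x"
  shows "weakly_null (\<lambda>a. T (x a)) (tails A le)"
proof -
  obtain B leB y where y: "order_null (B :: 'a idx set) leB y"
    "filtermap x (tails A le) \<le> filtermap y (tails B leB)"
    using order_null_net_reindex[OF assms(2)] by metis
  have "weakly_null (\<lambda>b. T (y b)) (tails B leB)"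
    using assms(1) y(1) by (auto simp: L_owc_def)
  then show ?thesis
    using tendsto_via_filtermap[OF y(2), of "\<lambda>v. f (T v)" 0 for f]
    by (auto simp: weakly_null_def)
qed

end

theory Submission
  imports Defs
begin

text \<open>
  The inclusions from right to left hold because a net that decreases to \<open>0\<close> dominates itself and
  therefore order converges to \<open>0\<close>.

  For the other inclusions, the point is that a \<open>\<sigma>\<close>-Lebesgue operator \<open>T\<close> on \<open>X\<close> is automatically
  norm continuous (\<open>bounded_linear_if_L_Leb_sigma\<close>). Once this is known, a net that order converges
  to \<open>0\<close> converges to \<open>0\<close> in norm by order continuity of the norm of \<open>X\<close>, and its image under \<open>T\<close>
  does too. A weakly \<open>\<sigma>\<close>-Lebesgue operator becomes a \<open>\<sigma>\<close>-Lebesgue functional after composition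
  with any bounded functional, so the weak statements follow from the norm statements with target
  \<open>\<real>\<close>. Lebesgue operators are \<open>\<sigma>\<close>-Lebesgue, so the argument covers nets as well as sequences.

  Continuity of \<open>T\<close> has two ingredients. First, \<open>T\<close> is bounded on the positive part of the unit
  ball (\<open>L_Leb_sigma_bounded_on_cone\<close>). As \<open>T\<close> is not positive, no estimate of the form
  \<open>0 \<le> u \<le> v\<close> helps to control \<open>T u\<close>; instead, a positive \<open>w\<^sub>k\<close> is written as a difference
  \<open>v\<^sub>k - v\<^sub>k\<^sub>+\<^sub>1\<close> of consecutive tails of the series \<open>\<Sum> w\<^sub>k\<close>, and these tails decrease to \<open>0\<close>
  because the cone is closed. Second, every \<open>x\<close> is a difference of positive vectors whose norms are
  at most a fixed multiple of the norm of \<open>x\<close> (\<open>bounded_decomposition\<close>, the theorem of Krein and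
  Smulian). This is a Baire category argument in the manner of the open mapping theorem: the Baire
  theorem yields bounded decompositions up to a small error, and completeness together with
  closedness of the cone allows the error to be decomposed again and the parts to be summed.
\<close>

section \<open>Positive series in an ordered Banach space with closed cone\<close>

lemma nonneg_LIMSEQ:
  fixes s :: "nat \<Rightarrow> 'a::{ordered_real_vector, real_normed_vector}"
  assumes "closed (pos_cone :: 'a set)" and "\<And>n. 0 \<le> s n" and "s \<longlonglongrightarrow> l"
  shows "0 \<le> l"
  using closed_sequentially[OF assms(1) _ assms(3)] assms(2) by (simp add: pos_cone_def)

lemma nonneg_suminf:
  fixes u :: "nat \<Rightarrow> 'a::{ordered_real_vector, real_normed_vector}"
  assumes "closed (pos_cone :: 'a set)" and "\<And>n. 0 \<le> u n" and "summable u"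
  shows "0 \<le> suminf u"
  using nonneg_LIMSEQ[OF assms(1) _ summable_LIMSEQ[OF assms(3)]] assms(2) by (simp add: sum_nonneg)

text \<open>
  The tails of a convergent series tend to \<open>0\<close> in norm, and for a closed cone any lower bound of
  a norm null sequence is \<open>\<le> 0\<close>.
\<close>

lemma tails_decrease_to_zero:
  fixes u :: "nat \<Rightarrow> 'a::{ordered_real_vector, real_normed_vector}"
  assumes closed: "closed (pos_cone :: 'a set)" and pos: "\<And>n. 0 \<le> u n" and sum: "summable u"
  shows "decreases_to_zero UNIV (\<le>) (\<lambda>k. \<Sum>n. u (n + k))"
proof -
  let ?v = "\<lambda>k. \<Sum>n. u (n + k)"
  have v: "?v k = suminf u - (\<Sum>i<k. u i)" for k
    by (rule suminf_minus_initial_segment[OF sum])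
  have "(\<lambda>k. suminf u - (\<Sum>i<k. u i)) \<longlonglongrightarrow> suminf u - suminf u"
    by (intro tendsto_intros summable_LIMSEQ[OF sum])
  then have lim: "?v \<longlonglongrightarrow> 0" by (simp add: v)
  have "?v k \<le> ?v j" if "j \<le> k" for j k
    unfolding v using that pos by (intro diff_left_mono sum_mono2) auto
  moreover have "0 \<le> ?v k" for k
    using closed pos summable_ignore_initial_segment[OF sum] by (intro nonneg_suminf)
  moreover have "z \<le> 0" if "\<And>k. z \<le> ?v k" for z
  proof -
    have "(\<lambda>k. ?v k - z) \<longlonglongrightarrow> 0 - z" by (intro tendsto_intros lim)
    from nonneg_LIMSEQ[OF closed _ this] that show ?thesis by simp
  qed
  ultimately show ?thesis
    by (auto simp: decreases_to_zero_def directed_by_nat monotone_on_def)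
qed

text \<open>
  If the conclusion failed, there would be positive \<open>w\<^sub>k\<close> with norms \<open>2\<^sup>-\<^sup>k\<close> whose images have
  norm \<open>> 1\<close>. But \<open>w\<^sub>k\<close> is the difference of two consecutive tails of the series \<open>\<Sum> w\<^sub>k\<close>, so \<open>T w\<^sub>k\<close>
  tends to \<open>0\<close>.
\<close>

lemma L_Leb_sigma_bounded_on_cone:
  fixes T :: "'a::{ordered_real_vector, banach} \<Rightarrow> 'b::real_normed_vector"
  assumes closed: "closed (pos_cone :: 'a set)" and T: "T \<in> L_Leb_sigma"
  shows "\<exists>M. \<forall>u\<ge>0. norm (T u) \<le> M * norm u"
proof (rule ccontr)
  assume "\<not> ?thesis"
  then have "\<forall>k. \<exists>u\<ge>0. norm (T u) > 2 ^ k * norm u"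
    by (meson not_le)
  then obtain u where u: "\<And>k. 0 \<le> u k" "\<And>k. norm (T (u k)) > 2 ^ k * norm (u k)"
    by metis
  have lin: "linear T" using T by (simp add: L_Leb_sigma_def)
  have u0: "norm (u k) > 0" for k
    using u(2)[of k] linear_0[OF lin] by (cases "u k = 0") auto
  define w where "w k = (1 / (2 ^ k * norm (u k))) *\<^sub>R u k" for k
  have w_pos: "0 \<le> w k" for k
    unfolding w_def using u(1) by (intro scaleR_nonneg_nonneg) auto
  have "norm (w k) = (1/2) ^ k" for k
    using u0[of k] by (simp add: w_def power_divide)
  then have "summable (\<lambda>k. norm (w k))" by (simp add: summable_geometric)
  then have w_sum: "summable w" by (rule summable_norm_cancel)
  have Tw: "1 < norm (T (w k))" for k
    using u0[of k] u(2)[of k] by (simp add: w_def linear_scale[OF lin])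
  define v where "v k = (\<Sum>n. w (n + k))" for k
  have "decreases_to_zero UNIV (\<le>) v"
    unfolding v_def by (rule tails_decrease_to_zero[OF closed w_pos w_sum])
  then have "(\<lambda>k. norm (T (v k))) \<longlonglongrightarrow> 0"
    using T by (auto simp: L_Leb_sigma_def)
  then have Tv: "(\<lambda>k. T (v k)) \<longlonglongrightarrow> 0" by (rule tendsto_norm_zero_cancel)
  have "w k = v k - v (Suc k)" for k
    by (simp add: v_def suminf_minus_initial_segment[OF w_sum] del: add_Suc_right)
  then have "T (w k) = T (v k) - T (v (Suc k))" for k
    by (simp add: linear_diff[OF lin])
  moreover have "(\<lambda>k. T (v k) - T (v (Suc k))) \<longlonglongrightarrow> 0 - 0"
    by (intro tendsto_intros Tv LIMSEQ_Suc)
  ultimately have "(\<lambda>k. norm (T (w k))) \<longlonglongrightarrow> 0"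
    by (simp add: tendsto_norm_zero_iff)
  then have "0 \<ge> (1::real)"
    using Tw by (intro LIMSEQ_le_const) (auto intro: less_imp_le)
  then show False by simp
qed

section \<open>Bounded decomposition into positive vectors\<close>

text \<open>
  The differences of positive vectors of norm at most \<open>n\<close> exhaust the space as \<open>n\<close> grows, so by
  Baire their closure contains a ball \<open>ball a r\<close> for some \<open>n\<close>. Subtracting approximants of \<open>a\<close>
  from approximants of \<open>a + x\<close> moves the ball to the origin, and the general case follows by scaling.
\<close>

lemma approximate_bounded_decomposition:
  assumes gen: "generating_cone TYPE('a::{ordered_real_vector, banach})"
  shows "\<exists>K\<ge>0. \<forall>x::'a. \<exists>u v. 0 \<le> u \<and> 0 \<le> v \<and> norm u \<le> K * norm x \<and>
    norm v \<le> K * norm x \<and> norm (x - (u - v)) \<le> norm x / 2"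
proof -
  define C :: "nat \<Rightarrow> 'a set"
    where "C n = {u - v |u v. 0 \<le> u \<and> 0 \<le> v \<and> norm u \<le> real n \<and> norm v \<le> real n}" for n
  have "\<exists>n. x \<in> C n" for x
  proof -
    have "x \<in> {u - v |u v. u \<in> pos_cone \<and> v \<in> pos_cone}"
      using gen unfolding generating_cone_def by blast
    then obtain u v where uv: "x = u - v" "0 \<le> u" "0 \<le> v"
      by (auto simp: pos_cone_def)
    obtain n where "max (norm u) (norm v) \<le> real n" using real_arch_simple by blast
    with uv show ?thesis by (auto simp: C_def)
  qed
  then have "x \<in> (\<Union>n. closure (C n))" for x
    by (meson UN_I UNIV_I closure_subset subsetD)
  then have cover: "(\<Union>n. closure (C n)) = UNIV" by (intro equalityI subsetI UNIV_I)
  have "\<exists>n. interior (closure (C n)) \<noteq> {}"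
  proof (rule ccontr)
    assume "\<not> ?thesis"
    then have "euclidean interior_of \<Union> (range (\<lambda>n. closure (C n))) = {}"
      by (intro Baire_category_alt) (auto simp: completely_metrizable_space_euclidean)
    with cover show False by simp
  qed
  then obtain n a where "a \<in> interior (closure (C n))" by blast
  then obtain r where r: "r > 0" "ball a r \<subseteq> closure (C n)" by (meson mem_interior)
  have small: "\<exists>u v. 0 \<le> u \<and> 0 \<le> v \<and> norm u \<le> 2 * n \<and> norm v \<le> 2 * n \<and>
      norm (x - (u - v)) < e" if "norm x < r" "e > 0" for x :: 'a and e
  proof -
    have "a + x \<in> closure (C n)" "a \<in> closure (C n)"
      using r that by (auto simp: dist_norm subset_iff)
    then obtain p q where pq: "p \<in> C n" "q \<in> C n" "dist p (a + x) < e/2" "dist q a < e/2"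
      using \<open>e > 0\<close> unfolding closure_approachable by (meson half_gt_zero)
    from pq(1) obtain p1 p2 where p: "p = p1 - p2" "0 \<le> p1" "0 \<le> p2"
      "norm p1 \<le> n" "norm p2 \<le> n" by (auto simp: C_def)
    from pq(2) obtain q1 q2 where q: "q = q1 - q2" "0 \<le> q1" "0 \<le> q2"
      "norm q1 \<le> n" "norm q2 \<le> n" by (auto simp: C_def)
    have "x - ((p1 + q2) - (p2 + q1)) = ((a + x) - p) - (a - q)"
      by (simp add: p q)
    also have "norm \<dots> \<le> norm ((a + x) - p) + norm (a - q)" by (rule norm_triangle_ineq4)
    also have "\<dots> < e" using pq(3,4) by (simp add: dist_norm norm_minus_commute)
    finally have "norm (x - ((p1 + q2) - (p2 + q1))) < e" .
    moreover have "norm (p1 + q2) \<le> 2 * n" "norm (p2 + q1) \<le> 2 * n"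
      using p q norm_triangle_ineq[of p1 q2] norm_triangle_ineq[of p2 q1] by linarith+
    ultimately show ?thesis
      using p q by (intro exI[of _ "p1 + q2"] exI[of _ "p2 + q1"]) auto
  qed
  show ?thesis
  proof (intro exI[of _ "4 * n / r"] conjI allI)
    show "0 \<le> 4 * n / r" using r by simp
    fix x :: 'a
    show "\<exists>u v. 0 \<le> u \<and> 0 \<le> v \<and> norm u \<le> 4 * n / r * norm x \<and> norm v \<le> 4 * n / r * norm x \<and>
       norm (x - (u - v)) \<le> norm x / 2"
    proof (cases "x = 0")
      case True
      then show ?thesis by (intro exI[of _ 0]) auto
    next
      case False
      define s where "s = r / (2 * norm x)"
      have s: "s > 0" using False r by (simp add: s_def)
      have "norm (s *\<^sub>R x) < r" using False r by (simp add: s_def)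
      then obtain u v where uv: "0 \<le> u" "0 \<le> v" "norm u \<le> 2 * n" "norm v \<le> 2 * n"
        "norm (s *\<^sub>R x - (u - v)) < r / 4"
        using small[of "s *\<^sub>R x" "r / 4"] r by auto
      have scale: "(2 * n) / s = 4 * n / r * norm x" "(r / 4) / s = norm x / 2"
        using False r by (auto simp: s_def field_simps)
      have bound: "norm ((1 / s) *\<^sub>R y) \<le> b / s" if "norm y \<le> b" for y :: 'a and b
        using that s by (simp add: divide_right_mono)
      have "x - ((1 / s) *\<^sub>R u - (1 / s) *\<^sub>R v) = (1 / s) *\<^sub>R (s *\<^sub>R x - (u - v))"
        using s by (simp add: algebra_simps)
      then have "norm (x - ((1 / s) *\<^sub>R u - (1 / s) *\<^sub>R v)) \<le> norm x / 2"
        using bound[OF less_imp_le[OF uv(5)]] by (simp only: scale)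
      moreover have "0 \<le> (1 / s) *\<^sub>R u" "0 \<le> (1 / s) *\<^sub>R v"
        using uv s by (auto intro!: scaleR_nonneg_nonneg)
      ultimately show ?thesis
        using bound[OF uv(3)] bound[OF uv(4)] unfolding scale by blast
    qed
  qed
qed

text \<open>
  Decomposing the remaining error again and again gives remainders of norm at most \<open>2\<^sup>-\<^sup>k\<close> times
  the norm of \<open>x\<close>, so the positive and the negative parts form absolutely convergent series. Their
  sums are positive because the cone is closed, and they are bounded by twice the constant of the
  approximate decomposition.
\<close>

lemma bounded_decomposition:
  assumes closed: "closed (pos_cone :: 'a::{ordered_real_vector, banach} set)"
    and gen: "generating_cone TYPE('a)"
  shows "\<exists>K. \<forall>x::'a. \<exists>u v. 0 \<le> u \<and> 0 \<le> v \<and> norm u \<le> K * norm x \<and> norm v \<le> K * norm x \<and>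
    x = u - v"
proof -
  obtain K where K: "K \<ge> 0" and "\<forall>x::'a. \<exists>u v. 0 \<le> u \<and> 0 \<le> v \<and> norm u \<le> K * norm x \<and>
      norm v \<le> K * norm x \<and> norm (x - (u - v)) \<le> norm x / 2"
    using approximate_bounded_decomposition[OF gen] by (elim exE conjE)
  then obtain p q :: "'a \<Rightarrow> 'a" where "\<forall>x. 0 \<le> p x \<and> 0 \<le> q x \<and> norm (p x) \<le> K * norm x \<and>
      norm (q x) \<le> K * norm x \<and> norm (x - (p x - q x)) \<le> norm x / 2"
    unfolding choice_iff by (elim exE)
  then have pos: "\<And>x. 0 \<le> p x" "\<And>x. 0 \<le> q x"
    and bnd: "\<And>x. norm (p x) \<le> K * norm x" "\<And>x. norm (q x) \<le> K * norm x"
    and err: "\<And>x. norm (x - (p x - q x)) \<le> norm x / 2"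
    by blast+
  show ?thesis
  proof (intro exI[of _ "2 * K"] allI)
    fix x :: 'a
    define R where "R k = ((\<lambda>y. y - (p y - q y)) ^^ k) x" for k
    have R_Suc: "R (Suc k) = R k - (p (R k) - q (R k))" for k by (simp add: R_def)
    have R_le: "norm (R k) \<le> (1/2) ^ k * norm x" for k
    proof (induction k)
      case (Suc k)
      then show ?case using err[of "R k"] by (simp add: R_Suc)
    qed (simp add: R_def)
    have geo: "(\<lambda>k. (1/2) ^ k * (K * norm x)) sums (2 * K * norm x)"
      using sums_mult2[OF geometric_sums[of "1/2::real"], of "K * norm x"] by (simp add: mult.assoc)
    have parts: "summable (\<lambda>k. f (R k)) \<and> norm (\<Sum>k. f (R k)) \<le> 2 * K * norm x"
      if f: "\<And>y. norm (f y) \<le> K * norm y" for f :: "'a \<Rightarrow> 'a"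
    proof -
      have le: "norm (f (R k)) \<le> (1/2) ^ k * (K * norm x)" for k
        using f[of "R k"] mult_left_mono[OF R_le[of k] K] by (simp add: ac_simps)
      have s: "summable (\<lambda>k. norm (f (R k)))"
        by (rule summable_comparison_test'[OF sums_summable[OF geo], of 0]) (simp add: le)
      have "norm (\<Sum>k. f (R k)) \<le> (\<Sum>k. norm (f (R k)))" by (rule summable_norm[OF s])
      also have "\<dots> \<le> 2 * K * norm x"
        using suminf_le[OF le s sums_summable[OF geo]] sums_unique[OF geo] by simp
      finally show ?thesis using summable_norm_cancel[OF s] by blast
    qed
    let ?u = "\<Sum>k. p (R k)" and ?v = "\<Sum>k. q (R k)"
    have "(\<lambda>k. (1/2) ^ k * norm x) \<longlonglongrightarrow> 0"
      by (intro tendsto_mult_left_zero LIMSEQ_realpow_zero) auto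
    then have "R \<longlonglongrightarrow> 0"
      by (rule Lim_null_comparison[rotated]) (simp add: R_le)
    then have "(\<lambda>k. R k - R (Suc k)) sums (R 0 - 0)" by (rule telescope_sums')
    then have "(\<lambda>k. p (R k) - q (R k)) sums x" by (simp add: R_Suc) (simp add: R_def)
    moreover have "(\<lambda>k. p (R k) - q (R k)) sums (?u - ?v)"
      using parts[OF bnd(1)] parts[OF bnd(2)] by (intro sums_diff summable_sums) auto
    ultimately have "x = ?u - ?v" by (rule sums_unique2)
    moreover have "0 \<le> ?u" "0 \<le> ?v"
      using parts[OF bnd(1)] parts[OF bnd(2)] pos by (auto intro!: nonneg_suminf[OF closed])
    ultimately show "\<exists>u v. 0 \<le> u \<and> 0 \<le> v \<and> norm u \<le> 2 * K * norm x \<and>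
        norm v \<le> 2 * K * norm x \<and> x = u - v"
      using parts[OF bnd(1)] parts[OF bnd(2)] by blast
  qed
qed

section \<open>Automatic continuity\<close>

theorem bounded_linear_if_L_Leb_sigma:
  fixes T :: "'a::{ordered_real_vector, banach} \<Rightarrow> 'b::real_normed_vector"
  assumes closed: "closed (pos_cone :: 'a set)" and gen: "generating_cone TYPE('a)"
    and T: "T \<in> L_Leb_sigma"
  shows "bounded_linear T"
proof -
  have lin: "linear T" using T by (simp add: L_Leb_sigma_def)
  obtain M0 where "\<And>u. 0 \<le> u \<Longrightarrow> norm (T u) \<le> M0 * norm u"
    using L_Leb_sigma_bounded_on_cone[OF closed T] by blast
  then have M: "norm (T u) \<le> \<bar>M0\<bar> * norm u" if "0 \<le> u" for u
    using that by (meson abs_ge_self mult_right_mono norm_ge_zero order_trans)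
  obtain K where K: "\<forall>x::'a. \<exists>u v. 0 \<le> u \<and> 0 \<le> v \<and> norm u \<le> K * norm x \<and>
      norm v \<le> K * norm x \<and> x = u - v"
    using bounded_decomposition[OF closed gen] by (elim exE)
  have "norm (T x) \<le> norm x * (2 * \<bar>M0\<bar> * K)" for x
  proof -
    obtain u v where uv: "0 \<le> u" "0 \<le> v" "norm u \<le> K * norm x" "norm v \<le> K * norm x" "x = u - v"
      using K by blast
    have "norm (T x) \<le> norm (T u) + norm (T v)"
      by (simp add: uv(5) linear_diff[OF lin] norm_triangle_ineq4)
    also have "\<dots> \<le> \<bar>M0\<bar> * norm u + \<bar>M0\<bar> * norm v" using M uv by (intro add_mono)
    also have "\<dots> \<le> \<bar>M0\<bar> * (K * norm x) + \<bar>M0\<bar> * (K * norm x)"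
      using uv by (intro add_mono mult_left_mono) auto
    finally show ?thesis by (simp add: algebra_simps)
  qed
  with lin show ?thesis
    by (intro bounded_linear_intro) (auto simp: linear_add linear_scale)
qed

text \<open>
  A functional applied to a weakly \<open>\<sigma>\<close>-Lebesgue operator is \<open>\<sigma>\<close>-Lebesgue, because weak and norm
  convergence agree in \<open>\<real>\<close>.
\<close>

corollary bounded_linear_functional_if_L_wLeb_sigma:
  fixes T :: "'a::{ordered_real_vector, banach} \<Rightarrow> 'b::real_normed_vector"
    and f :: "'b \<Rightarrow> real"
  assumes "closed (pos_cone :: 'a set)" and "generating_cone TYPE('a)"
    and T: "T \<in> L_wLeb_sigma" and f: "bounded_linear f"
  shows "bounded_linear (\<lambda>x. f (T x))"
proof (rule bounded_linear_if_L_Leb_sigma[OF assms(1,2)])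
  have "linear (\<lambda>x. f (T x))"
    using T linear_compose[OF _ bounded_linear.linear[OF f], of T]
    by (simp add: L_wLeb_sigma_def o_def)
  then show "(\<lambda>x. f (T x)) \<in> L_Leb_sigma"
    using T f by (auto simp: L_Leb_sigma_def L_wLeb_sigma_def weakly_null_def tendsto_rabs_zero_iff)
qed

section \<open>Comparison of the operator classes\<close>

lemma order_null_if_decreases_to_zero:
  assumes "decreases_to_zero A le x"
  shows "order_null A le x"
proof (rule order_null_any_index[OF _ assms])
  show "directed_by A le" using assms by (simp add: decreases_to_zero_def)
  have "x a \<le> x b \<and> - x a \<le> x b" if "a \<in> A" "b \<in> A" "le b a" for a b
  proof -
    have "x a \<le> x b" "0 \<le> x a"
      using assms that by (auto simp: decreases_to_zero_def monotone_on_def)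
    then show ?thesis by (meson neg_le_0_iff_le order_trans)
  qed
  then show "\<forall>b\<in>A. \<exists>a\<^sub>b\<in>A. \<forall>a\<in>A. le a\<^sub>b a \<longrightarrow> x a \<le> x b \<and> - x a \<le> x b"
    by blast
qed

lemma L_onc_subset_L_Leb: "L_onc \<subseteq> L_Leb" "L_onc_sigma \<subseteq> L_Leb_sigma"
  by (auto simp: L_onc_def L_Leb_def L_onc_sigma_def L_Leb_sigma_def
      intro: order_null_if_decreases_to_zero)

lemma L_owc_subset_L_wLeb: "L_owc \<subseteq> L_wLeb" "L_owc_sigma \<subseteq> L_wLeb_sigma"
  by (auto simp: L_owc_def L_wLeb_def L_owc_sigma_def L_wLeb_sigma_def
      intro: order_null_if_decreases_to_zero)

lemma L_Leb_subset_L_Leb_sigma: "L_Leb \<subseteq> L_Leb_sigma"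
proof
  fix T :: "'a \<Rightarrow> 'b" assume T: "T \<in> L_Leb"
  then show "T \<in> L_Leb_sigma"
    using L_Leb_any_index[OF T, of "UNIV :: nat set" "(\<le>)"]
    by (simp add: L_Leb_sigma_def tails_nat) (simp add: L_Leb_def)
qed

lemma L_wLeb_subset_L_wLeb_sigma: "L_wLeb \<subseteq> L_wLeb_sigma"
proof
  fix T :: "'a \<Rightarrow> 'b" assume T: "T \<in> L_wLeb"
  then show "T \<in> L_wLeb_sigma"
    using L_wLeb_any_index[OF T, of "UNIV :: nat set" "(\<le>)"]
    by (simp add: L_wLeb_sigma_def tails_nat) (simp add: L_wLeb_def)
qed

theorem theorem2p6:
  assumes "closed (pos_cone :: 'a::{ordered_real_vector, banach} set)"
    and "generating_cone TYPE('a)"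
    and "normal_cone TYPE('a)"
  shows "(sigma_order_continuous_norm TYPE('a) \<longrightarrow>
            (L_Leb_sigma :: ('a \<Rightarrow> 'b::real_normed_vector) set) = L_onc_sigma \<and>
            (L_wLeb_sigma :: ('a \<Rightarrow> 'b) set) = L_owc_sigma)
       \<and> (order_continuous_norm TYPE('a) \<longrightarrow>
            (L_Leb :: ('a \<Rightarrow> 'b) set) = L_onc \<and>
            (L_wLeb :: ('a \<Rightarrow> 'b) set) = L_owc)"
proof -
  have Leb: "((\<lambda>a. norm (T (x a))) \<longlongrightarrow> 0) F"
    if "T \<in> L_Leb_sigma" "((\<lambda>a. norm (x a)) \<longlongrightarrow> 0) F"
    for T :: "'a \<Rightarrow> 'b" and x :: "'i \<Rightarrow> 'a" and F
    using bounded_linear.tendsto_zero[OF bounded_linear_if_L_Leb_sigma[OF assms(1,2) that(1)]]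
      that(2) by (simp add: tendsto_norm_zero_iff)
  have wLeb: "weakly_null (\<lambda>a. T (x a)) F"
    if "T \<in> L_wLeb_sigma" "((\<lambda>a. norm (x a)) \<longlongrightarrow> 0) F"
    for T :: "'a \<Rightarrow> 'b" and x :: "'i \<Rightarrow> 'a" and F
    unfolding weakly_null_def
  proof (intro allI impI)
    fix f :: "'b \<Rightarrow> real" assume "bounded_linear f"
    then have "bounded_linear (\<lambda>x. f (T x))"
      by (rule bounded_linear_functional_if_L_wLeb_sigma[OF assms(1,2) that(1)])
    from bounded_linear.tendsto_zero[OF this, of x F] that(2)
    show "((\<lambda>a. f (T (x a))) \<longlongrightarrow> 0) F" by (simp add: tendsto_norm_zero_iff)
  qed
  show ?thesis
  proof (intro conjI impI subset_antisym L_onc_subset_L_Leb L_owc_subset_L_wLeb)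
    assume "sigma_order_continuous_norm TYPE('a)"
    then have null: "(\<lambda>n. norm (x n)) \<longlonglongrightarrow> 0" if "order_null UNIV (\<le>) x" for x :: "nat \<Rightarrow> 'a"
      using that by (simp add: sigma_order_continuous_norm_def)
    show "(L_Leb_sigma :: ('a \<Rightarrow> 'b) set) \<subseteq> L_onc_sigma"
      using Leb null by (force simp: L_onc_sigma_def L_Leb_sigma_def)
    show "(L_wLeb_sigma :: ('a \<Rightarrow> 'b) set) \<subseteq> L_owc_sigma"
      using wLeb null by (force simp: L_owc_sigma_def L_wLeb_sigma_def)
  next
    assume "order_continuous_norm TYPE('a)"
    then have null: "((\<lambda>a. norm (x a)) \<longlongrightarrow> 0) (tails A le)" if "order_null A le x"
      for A :: "'a idx set" and le and x :: "'a idx \<Rightarrow> 'a"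
      using that by (simp add: order_continuous_norm_def)
    show "(L_Leb :: ('a \<Rightarrow> 'b) set) \<subseteq> L_onc"
    proof
      fix T :: "'a \<Rightarrow> 'b" assume T: "T \<in> L_Leb"
      show "T \<in> L_onc"
        using T Leb[OF subsetD[OF L_Leb_subset_L_Leb_sigma T] null] by (auto simp: L_onc_def L_Leb_def)
    qed
    show "(L_wLeb :: ('a \<Rightarrow> 'b) set) \<subseteq> L_owc"
    proof
      fix T :: "'a \<Rightarrow> 'b" assume T: "T \<in> L_wLeb"
      show "T \<in> L_owc"
        using T wLeb[OF subsetD[OF L_wLeb_subset_L_wLeb_sigma T] null] by (auto simp: L_owc_def L_wLeb_def)
    qed
  qed
qed

end
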